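(* Let $p>0$ be an integer, let $\Sigma$ be a finite alphabet, let $\sim$ be a $\mathbf{ZG}_p$-congruence over $\Sigma^*$, and let $M:=\Sigma^*/{\sim}$ be the quotient monoid. Let $n:=|M|+1$. Then $\sim$ is refined by the $n,p$-congruence on $\Sigma$, i.e., for all $u,v\in\Sigma^*$, if $u\sim_{n,p}v$ then $u\sim v$.
   Context: For a finite monoid $M$, the idempotent power $\omega>0$ of $M$ is the least positive integer such that $x^\omega$ is idempotent for every $x\in M$. For an integer $p>0$, $\mathbf{ZG}_p$ is the class (variety) of finite monoids satisfying, for all elements $x,y$, the equations $x^{\omega+1}y=yx^{\omega+1}$ and $x^{\omega+p}=x^\omega$. A congruence on $\Sigma$ is an equivalence relation $\sim$ on $\Sigma^*$ such that $x\sim y$ and $z\sim t$ imply $xz\sim yt$. It is a $\mathbf{ZG}_p$-congruence if it has finitely many classes and the quotient monoid $\Sigma^*/{\sim}$ is in $\mathbf{ZG}_p$. For $w\in\Sigma^*$ and $a\in\Sigma$, $|w|_a$ is the number of occurrences of $a$ in $w$. Given a threshold $n$, a letter $a\in\Sigma$ is rare in $w$ if $|w|_a\le n$ and frequent in $w$ if $|w|_a>n$. The rare subword $w_{|\le n}$ is the subword of $w$ obtained by keeping only the occurrences of letters that are rare in $w$. For $n,p>0$, the $n,p$-congruence $\sim_{n,p}$ on $\Sigma^*$ is defined by: $u\sim_{n,p}v$ iff (i) $u_{|\le n}=v_{|\le n}$; (ii) for all $a\in\Sigma$, $|u|_a>n$ iff $|v|_a>n$; and (iii) for all $a\in\Sigma$,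 $|u|_a\equiv|v|_a\pmod p$. *)

theory Defs
  imports "HOL-Algebra.Group" "HOL-Number_Theory.Cong"
begin

text \<open>
  An alphabet is a set \<open>\<Sigma>\<close>, and \<open>\<Sigma>\<^sup>*\<close> is \<^term>\<open>lists \<Sigma>\<close>, a monoid under concatenation.
\<close>

definition word_congruence :: "'a set \<Rightarrow> ('a list \<times> 'a list) set \<Rightarrow> bool" where
  "word_congruence \<Sigma> R \<longleftrightarrow>
     equiv (lists \<Sigma>) R \<and>
     (\<forall>x y z t. (x, y) \<in> R \<longrightarrow> (z, t) \<in> R \<longrightarrow> (x @ z, y @ t) \<in> R)"

text \<open>
  For a congruence \<open>R\<close>, all the classes in the union below coincide, so the product of the classes
  of \<open>u\<close> and \<open>v\<close> is the class of \<open>u @ v\<close>; see \<open>word_quotient_mult\<close>.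
\<close>

definition word_quotient :: "'a set \<Rightarrow> ('a list \<times> 'a list) set \<Rightarrow> 'a list set monoid" where
  "word_quotient \<Sigma> R =
     \<lparr>carrier = lists \<Sigma> // R,
      monoid.mult = (\<lambda>A B. \<Union>u\<in>A. \<Union>v\<in>B. R `` {u @ v}),
      monoid.one = R `` {[]}\<rparr>"

lemma word_quotient_mult:
  assumes "word_congruence \<Sigma> R" and "u \<in> lists \<Sigma>" and "v \<in> lists \<Sigma>"
  shows "R `` {u} \<otimes>\<^bsub>word_quotient \<Sigma> R\<^esub> R `` {v} = R `` {u @ v}"
proof -
  have eq: "equiv (lists \<Sigma>) R"
    and cong: "\<And>x y z t. (x, y) \<in> R \<Longrightarrow> (z, t) \<in> R \<Longrightarrow> (x @ z, y @ t) \<in> R"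
    using assms(1) by (auto simp: word_congruence_def)
  have same_class: "R `` {x @ y} = R `` {u @ v}" if "x \<in> R `` {u}" "y \<in> R `` {v}" for x y
    using equiv_class_eq[OF eq cong[of u x v y]] that by simp
  have self: "u \<in> R `` {u}" "v \<in> R `` {v}"
    using equiv_class_self[OF eq] assms(2,3) by simp_all
  have "R `` {u} \<otimes>\<^bsub>word_quotient \<Sigma> R\<^esub> R `` {v} = (\<Union>x\<in>R `` {u}. \<Union>y\<in>R `` {v}. R `` {x @ y})"
    by (simp add: word_quotient_def)
  also have "\<dots> = (\<Union>x\<in>R `` {u}. \<Union>y\<in>R `` {v}. R `` {u @ v})"
    by (intro SUP_cong refl same_class)
  also have "\<dots> = R `` {u @ v}"
    using self by blast
  finally show ?thesis .
qed

lemma monoid_word_quotient: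
  assumes "word_congruence \<Sigma> R"
  shows "monoid (word_quotient \<Sigma> R)"
proof -
  let ?M = "word_quotient \<Sigma> R"
  note mult = word_quotient_mult[OF assms]
  have carrI: "R `` {u} \<in> carrier ?M" if "u \<in> lists \<Sigma>" for u
    using that by (simp add: word_quotient_def quotientI)
  have carrE: "\<exists>u\<in>lists \<Sigma>. x = R `` {u}" if "x \<in> carrier ?M" for x
    using that by (auto simp: word_quotient_def elim: quotientE)
  have one: "\<one>\<^bsub>?M\<^esub> = R `` {[]}"
    by (simp add: word_quotient_def)
  have nil: "[] \<in> lists \<Sigma>"
    by simp
  have app: "u @ v \<in> lists \<Sigma>" if "u \<in> lists \<Sigma>" "v \<in> lists \<Sigma>" for u v
    using that by simp
  show ?thesis
  proof (rule monoidI)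
    fix x y assume "x \<in> carrier ?M" "y \<in> carrier ?M"
    then obtain u v where "u \<in> lists \<Sigma>" "x = R `` {u}" "v \<in> lists \<Sigma>" "y = R `` {v}"
      using carrE by meson
    then show "x \<otimes>\<^bsub>?M\<^esub> y \<in> carrier ?M"
      by (simp only: mult app carrI)
  next
    show "\<one>\<^bsub>?M\<^esub> \<in> carrier ?M"
      by (simp only: one carrI nil)
  next
    fix x y z assume "x \<in> carrier ?M" "y \<in> carrier ?M" "z \<in> carrier ?M"
    then obtain u v w where "u \<in> lists \<Sigma>" "x = R `` {u}" "v \<in> lists \<Sigma>" "y = R `` {v}"
        "w \<in> lists \<Sigma>" "z = R `` {w}"
      using carrE by meson
    then show "x \<otimes>\<^bsub>?M\<^esub> y \<otimes>\<^bsub>?M\<^esub> z = x \<otimes>\<^bsub>?M\<^esub> (y \<otimes>\<^bsub>?M\<^esub> z)"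
      by (simp only: mult app append_assoc)
  next
    fix x assume "x \<in> carrier ?M"
    then obtain u where "u \<in> lists \<Sigma>" "x = R `` {u}"
      using carrE by meson
    then show "\<one>\<^bsub>?M\<^esub> \<otimes>\<^bsub>?M\<^esub> x = x" "x \<otimes>\<^bsub>?M\<^esub> \<one>\<^bsub>?M\<^esub> = x"
      by (simp_all only: one mult nil append_Nil append_Nil2)
  qed
qed

definition idempotent_power :: "('m, 'b) monoid_scheme \<Rightarrow> nat" where
  "idempotent_power M =
     (LEAST k. 0 < k \<and>
        (\<forall>x\<in>carrier M. (x [^]\<^bsub>M\<^esub> k) \<otimes>\<^bsub>M\<^esub> (x [^]\<^bsub>M\<^esub> k) = x [^]\<^bsub>M\<^esub> k))"

definition ZG :: "nat \<Rightarrow> ('m, 'b) monoid_scheme \<Rightarrow> bool" where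
  "ZG p M \<longleftrightarrow>
     monoid M \<and> finite (carrier M) \<and>
     (\<forall>x\<in>carrier M. \<forall>y\<in>carrier M.
        x [^]\<^bsub>M\<^esub> (idempotent_power M + 1) \<otimes>\<^bsub>M\<^esub> y = y \<otimes>\<^bsub>M\<^esub> x [^]\<^bsub>M\<^esub> (idempotent_power M + 1)) \<and>
     (\<forall>x\<in>carrier M. x [^]\<^bsub>M\<^esub> (idempotent_power M + p) = x [^]\<^bsub>M\<^esub> idempotent_power M)"

definition ZG_congruence :: "nat \<Rightarrow> 'a set \<Rightarrow> ('a list \<times> 'a list) set \<Rightarrow> bool" where
  "ZG_congruence p \<Sigma> R \<longleftrightarrow>
     word_congruence \<Sigma> R \<and> finite (lists \<Sigma> // R) \<and> ZG p (word_quotient \<Sigma> R)"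

definition rare_subword :: "nat \<Rightarrow> 'a list \<Rightarrow> 'a list" where
  "rare_subword n w = filter (\<lambda>a. count_list w a \<le> n) w"

definition np_congruence :: "'a set \<Rightarrow> nat \<Rightarrow> nat \<Rightarrow> ('a list \<times> 'a list) set" where
  "np_congruence \<Sigma> n p =
     {(u, v). u \<in> lists \<Sigma> \<and> v \<in> lists \<Sigma> \<and>
        rare_subword n u = rare_subword n v \<and>
        (\<forall>a\<in>\<Sigma>. n < count_list u a \<longleftrightarrow> n < count_list v a) \<and>
        (\<forall>a\<in>\<Sigma>. [count_list u a = count_list v a] (mod p))}"

end

theory Submission
  imports Defs
begin

text \<open>
  Write \<open>x\<^sup>\<omega>\<close> for the idempotent power. In a monoid of \<open>ZG\<^sub>p\<close> every \<open>x\<^sup>\<omega>\<close> is central, and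
  \<open>(x y)\<^sup>\<omega> = (x y)\<^sup>\<omega> x\<^sup>\<omega>\<close>. If a letter \<open>a\<close> occurs more than \<open>|M|\<close> times in \<open>w\<close>, then by the
  pigeonhole principle two prefixes of \<open>w\<close> that are followed by \<open>a\<close> have the same image \<open>m\<close>, so that
  \<open>m = m s = m s\<^sup>\<omega>\<close> for some factor \<open>s\<close> starting with \<open>a\<close>; hence \<open>m = m a\<^sup>\<omega>\<close>, and the image of \<open>w\<close>
  absorbs \<open>a\<^sup>\<omega>\<close>. The absorbed \<open>a\<^sup>\<omega>\<close> turns each occurrence of \<open>a\<close> into the central element
  \<open>a\<^bsup>\<omega>+1\<^esup>\<close>, so all the frequent letters can be pulled out of the word, and the number of their
  occurrences matters only modulo \<open>p\<close>.
\<close>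

section \<open>Idempotent powers in finite monoids\<close>

context monoid
begin

lemma idempotent_pow_Suc:
  assumes "e \<in> carrier G" "e \<otimes> e = e"
  shows "e [^] Suc k = e"
  using assms by (induction k) simp_all

text \<open>This is the witness that gives meaning to the \<open>LEAST\<close> in
  \<open>idempotent_power\<close>. With N = |M|, the powers of each element become periodic from
  some i \<le> N on, with a period j - i \<le> N. The exponent N! is at least i and a multiple of
  the period, whatever the element.\<close>

lemma finite_imp_uniform_idempotent_power:
  assumes "finite (carrier G)"
  shows "\<exists>k>0. \<forall>x\<in>carrier G. x [^] k \<otimes> x [^] k = x [^] (k::nat)"
proof (intro exI conjI ballI)
  let ?N = "card (carrier G)"
  show "0 < (fact ?N :: nat)"
    by simp
  fix x assume x: "x \<in> carrier G"
  have "\<not> inj_on (\<lambda>i::nat. x [^] i) {..?N}"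
  proof (rule pigeonhole)
    have "card ((\<lambda>i::nat. x [^] i) ` {..?N}) \<le> ?N"
      using x by (intro card_mono assms) auto
    then show "card ((\<lambda>i::nat. x [^] i) ` {..?N}) < card {..?N}"
      by simp
  qed
  then obtain i j :: nat where ij: "i < j" "j \<le> ?N" and eq: "x [^] i = x [^] j"
    unfolding inj_on_def by (metis atMost_iff linorder_neqE_nat)
  have shift: "x [^] (m + (j - i)) = x [^] m" if "i \<le> m" for m
  proof -
    have "m + (j - i) = j + (m - i)"
      using ij that by simp
    then have "x [^] (m + (j - i)) = x [^] j \<otimes> x [^] (m - i)"
      using x by (simp only: nat_pow_mult)
    also have "\<dots> = x [^] m"
      using x that by (simp add: eq[symmetric] nat_pow_mult)
    finally show ?thesis .
  qed
  have shifts: "x [^] (m + t * (j - i)) = x [^] m" if "i \<le> m" for m t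
  proof (induction t)
    case (Suc t)
    then show ?case
      using shift[of "m + t * (j - i)"] that by (simp add: ac_simps)
  qed simp
  have "(j - i) dvd (fact ?N :: nat)"
    using ij by (intro dvd_fact) auto
  then obtain t where t: "(fact ?N :: nat) = t * (j - i)"
    by (metis dvd_def mult.commute)
  have "i \<le> fact ?N"
    using ij fact_ge_self[of ?N] by linarith
  then have "x [^] (fact ?N + fact ?N :: nat) = x [^] (fact ?N :: nat)"
    using shifts[of "fact ?N" t] t by simp
  then show "x [^] (fact ?N :: nat) \<otimes> x [^] (fact ?N :: nat) = x [^] (fact ?N :: nat)"
    using x by (simp add: nat_pow_mult)
qed

lemma idempotent_power:
  assumes "finite (carrier G)"
  shows "0 < idempotent_power G"
    and "x \<in> carrier G \<Longrightarrow>
      x [^] idempotent_power G \<otimes> x [^] idempotent_power G = x [^] idempotent_power G"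
  using LeastI_ex[OF finite_imp_uniform_idempotent_power[OF assms]]
  unfolding idempotent_power_def by blast+

end

section \<open>Central powers and periodicity in a monoid of \<open>ZG p\<close>\<close>

locale ZG_monoid = monoid M for M (structure) +
  fixes p :: nat
  assumes ZG: "ZG p M"
begin

abbreviation \<omega> :: nat where "\<omega> \<equiv> idempotent_power M"

lemma finite_carrier: "finite (carrier M)"
  using ZG by (simp add: ZG_def)

lemma omega_pos: "0 < \<omega>"
  by (rule idempotent_power(1)[OF finite_carrier])

lemma omega_idem: "x \<in> carrier M \<Longrightarrow> x [^] \<omega> \<otimes> x [^] \<omega> = x [^] \<omega>"
  by (rule idempotent_power(2)[OF finite_carrier])

lemma omega_Suc_central:
  "x \<in> carrier M \<Longrightarrow> y \<in> carrier M \<Longrightarrow> x [^] (\<omega> + 1) \<otimes> y = y \<otimes> x [^] (\<omega> + 1)"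
  using ZG by (simp add: ZG_def)

text \<open>The commutation axiom is applied to x^\<omega> itself: being idempotent, it equals its
  own power of exponent \<omega> + 1.\<close>

lemma omega_central:
  assumes "x \<in> carrier M" "y \<in> carrier M"
  shows "x [^] \<omega> \<otimes> y = y \<otimes> x [^] \<omega>"
  using omega_Suc_central[of "x [^] \<omega>" y] idempotent_pow_Suc[of "x [^] \<omega>" \<omega>] omega_idem assms by simp

lemma omega_period:
  assumes x: "x \<in> carrier M" and cong: "[c = d] (mod p)"
  shows "x [^] (\<omega> + c) = x [^] (\<omega> + d)"
proof -
  have step: "x [^] (\<omega> + m + p) = x [^] (\<omega> + m)" for m
  proof -
    have "x [^] (\<omega> + m + p) = x [^] (\<omega> + p) \<otimes> x [^] m"
      using x by (simp add: nat_pow_mult ac_simps)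
    also have "\<dots> = x [^] \<omega> \<otimes> x [^] m"
      using ZG x by (simp add: ZG_def)
    finally show ?thesis
      using x by (simp add: nat_pow_mult)
  qed
  have steps: "x [^] (\<omega> + (m + p * k)) = x [^] (\<omega> + m)" for m k
  proof (induction k)
    case (Suc k)
    then show ?case
      using step[of "m + p * k"] by (simp add: algebra_simps)
  qed simp
  \<comment> \<open>Adding multiples of \<open>p\<close> on both sides avoids a case distinction on
    which of \<open>c\<close> and \<open>d\<close> is larger.\<close>
  obtain k l where "c + p * k = d + p * l"
    using cong by (metis cong_iff_lin_nat mult.commute)
  then show ?thesis
    by (metis steps)
qed

text \<open>
  The central idempotent \<open>e = (x y)\<^sup>\<omega>\<close> has the form \<open>x z\<close>, so \<open>e = x e z = x\<^sup>2 z\<^sup>2 = \<dots> = x\<^sup>\<omega> z\<^sup>\<omega>\<close>.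
\<close>

lemma omega_mult_absorb_left:
  assumes x: "x \<in> carrier M" and y: "y \<in> carrier M"
  shows "(x \<otimes> y) [^] \<omega> \<otimes> x [^] \<omega> = (x \<otimes> y) [^] \<omega>"
proof -
  define e where "e = (x \<otimes> y) [^] \<omega>"
  define z where "z = y \<otimes> (x \<otimes> y) [^] (\<omega> - 1)"
  have z: "z \<in> carrier M" and e: "e \<in> carrier M"
    using x y by (simp_all add: z_def e_def)
  have "e = (x \<otimes> y) [^] (1 + (\<omega> - 1))"
    using omega_pos by (simp add: e_def)
  also have "\<dots> = x \<otimes> z"
    using x y by (simp only: nat_pow_mult[symmetric] m_closed) (simp add: z_def m_assoc)
  finally have exz: "e = x \<otimes> z" .
  have pow: "e = x [^] Suc k \<otimes> z [^] Suc k" for k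
  proof (induction k)
    case 0
    then show ?case using exz x z by simp
  next
    case (Suc k)
    have "e = e \<otimes> e"
      using omega_idem x y by (simp add: e_def)
    also have "\<dots> = x \<otimes> e \<otimes> z"
      using omega_central[of "x \<otimes> y" x] x y z e
      by (metis e_def exz m_assoc m_closed)
    also have "\<dots> = x \<otimes> (x [^] Suc k \<otimes> z [^] Suc k) \<otimes> z"
      using Suc by simp
    also have "\<dots> = (x \<otimes> x [^] Suc k) \<otimes> (z [^] Suc k \<otimes> z)"
      using x z by (simp add: m_assoc)
    also have "\<dots> = x [^] Suc (Suc k) \<otimes> z [^] Suc (Suc k)"
      using x z by (simp only: nat_pow_Suc2[of x "Suc k"] nat_pow_Suc[of z "Suc k"])
    finally show ?case .
  qed
  have exz': "e = x [^] \<omega> \<otimes> z [^] \<omega>"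
    using pow[of "\<omega> - 1"] omega_pos by simp
  then have "x [^] \<omega> \<otimes> e = e"
    using omega_idem[OF x] x z by (metis m_assoc nat_pow_closed)
  then show ?thesis
    using omega_central[OF x e] by (simp add: e_def)
qed

end

section \<open>Morphisms from words to a monoid of \<open>ZG p\<close>\<close>

locale ZG_morphism = ZG_monoid +
  fixes \<Sigma> :: "'c set" and h :: "'c list \<Rightarrow> 'a"
  assumes h_closed: "w \<in> lists \<Sigma> \<Longrightarrow> h w \<in> carrier M"
    and h_Nil: "h [] = \<one>"
    and h_append: "u \<in> lists \<Sigma> \<Longrightarrow> v \<in> lists \<Sigma> \<Longrightarrow> h (u @ v) = h u \<otimes> h v"
begin

lemma h_Cons: "a \<in> \<Sigma> \<Longrightarrow> w \<in> lists \<Sigma> \<Longrightarrow> h (a # w) = h [a] \<otimes> h w"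
  using h_append[of "[a]" w] by simp

lemma letter_closed: "a \<in> \<Sigma> \<Longrightarrow> h [a] \<in> carrier M"
  by (rule h_closed) simp

lemma frequent_absorb:
  assumes w: "w \<in> lists \<Sigma>" and a: "a \<in> \<Sigma>"
    and freq: "card (carrier M) < count_list w a"
  shows "h [a] [^] \<omega> \<otimes> h w = h w"
proof -
  let ?I = "{k. k < length w \<and> w ! k = a}" and ?f = "\<lambda>k. h (take k w)"
  have take: "take k w \<in> lists \<Sigma>" and drop: "drop k w \<in> lists \<Sigma>" for k
    using w by (auto dest: in_set_takeD in_set_dropD)
  have "\<not> inj_on ?f ?I"
  proof (rule pigeonhole)
    have "card (?f ` ?I) \<le> card (carrier M)"
      using take by (intro card_mono finite_carrier) (auto intro: h_closed)
    also have "\<dots> < card ?I"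
      using freq by (simp add: count_list_eq_length_filter length_filter_conv_card eq_commute)
    finally show "card (?f ` ?I) < card ?I" .
  qed
  then obtain k l where kl: "k < l" "l < length w" "w ! k = a" and eq: "?f k = ?f l"
    unfolding inj_on_def by (metis (mono_tags, lifting) linorder_neqE_nat mem_Collect_eq)
  \<comment> \<open>The factor of \<open>w\<close> strictly between positions \<open>k\<close> and
    \<open>l\<close>; the longer prefix is then the shorter one followed by
    \<open>a # t\<close>.\<close>
  define t where "t = take (l - Suc k) (drop (Suc k) w)"
  have t: "t \<in> lists \<Sigma>"
    using drop by (auto simp: t_def dest: in_set_takeD)
  have "take l w = take k w @ take (l - k) (drop k w)"
    using kl by (metis le_add_diff_inverse less_imp_le take_add)
  moreover have "drop k w = a # drop (Suc k) w"
    using kl by (simp add: Cons_nth_drop_Suc[symmetric])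
  ultimately have prefix: "take l w = take k w @ a # t"
    using kl by (simp add: t_def take_Cons' Suc_diff_Suc[symmetric])
  define m s where "m = ?f k" and "s = h [a] \<otimes> h t"
  have m: "m \<in> carrier M" and s: "s \<in> carrier M"
    using take t a by (simp_all add: m_def s_def h_closed letter_closed)
  have ms: "m \<otimes> s = m"
    using h_append[OF take, of "a # t" k] h_Cons[OF a t] t a eq prefix by (simp add: m_def s_def)
  have "m \<otimes> s [^] i = m" for i :: nat
    using m s ms by (induction i) (simp_all add: m_assoc[symmetric])
  \<comment> \<open>Taking i = \<omega> gives m = m s^\<omega>, and s^\<omega> absorbs a^\<omega> on
    the right because \<open>s\<close> has the image of \<open>a\<close> as its left factor.\<close>
  then have "m \<otimes> h [a] [^] \<omega> = m"
    using omega_mult_absorb_left[of "h [a]" "h t"] m s a t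
    by (metis h_closed letter_closed m_assoc nat_pow_closed s_def)
  then have "h [a] [^] \<omega> \<otimes> m = m"
    using omega_central m a by (simp add: letter_closed)
  moreover have "h w = m \<otimes> h (drop k w)"
    using h_append[OF take drop, of k k] by (simp add: m_def)
  ultimately show ?thesis
    using m a drop by (metis h_closed letter_closed m_assoc nat_pow_closed)
qed

text \<open>The central a^\<omega> passes the first letter and reaches the tail, where the induction
  hypothesis applies. The power of \<open>a\<close> obtained there moves back to the front, gaining
  one if the first letter is \<open>a\<close>.\<close>

lemma pull_out_letter:
  assumes a: "a \<in> \<Sigma>" and w: "w \<in> lists \<Sigma>"
  shows "h [a] [^] \<omega> \<otimes> h w = h [a] [^] (\<omega> + count_list w a) \<otimes> h (filter (\<lambda>b. b \<noteq> a) w)"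
  using w
proof (induction w)
  case Nil
  then show ?case by simp
next
  case (Cons b w)
  let ?x = "h [a]" and ?w = "filter (\<lambda>b. b \<noteq> a) w"
  have carr: "?x \<in> carrier M" "h [b] \<in> carrier M" "h w \<in> carrier M" "h ?w \<in> carrier M"
    using Cons.hyps a by (auto intro!: h_closed)
  have w': "w \<in> lists \<Sigma>" "?w \<in> lists \<Sigma>" and b: "b \<in> \<Sigma>"
    using Cons.hyps by auto
  show ?case
  proof (cases "b = a")
    case True
    have "?x [^] \<omega> \<otimes> h (b # w) = ?x \<otimes> (?x [^] \<omega> \<otimes> h w)"
      using True carr h_Cons[OF b w'(1)] omega_central[of ?x ?x]
      by (simp add: m_assoc[symmetric])
    also have "\<dots> = ?x \<otimes> ?x [^] (\<omega> + count_list w a) \<otimes> h ?w"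
      using Cons.IH carr by (simp add: m_assoc)
    also have "\<dots> = ?x [^] (\<omega> + count_list (b # w) a) \<otimes> h ?w"
      using True carr nat_pow_Suc2[of ?x "\<omega> + count_list w a"] by simp
    finally show ?thesis using True by simp
  next
    case False
    have comm: "?x [^] (\<omega> + c) \<otimes> h [b] = h [b] \<otimes> ?x [^] (\<omega> + c)" for c
    proof (induction c)
      case 0
      then show ?case using omega_central carr by simp
    next
      case (Suc c)
      \<comment> \<open>Doubling the idempotent x^\<omega> leaves one copy for each factor: the
        second is central by the axiom, the first commutes with \<open>h [b]\<close> by
        induction.\<close>
      have split: "?x [^] (\<omega> + Suc c) = ?x [^] (\<omega> + c) \<otimes> ?x [^] (\<omega> + 1)"
      proof -
        have "?x [^] (\<omega> + Suc c) = ?x [^] \<omega> \<otimes> ?x [^] Suc c"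
          using carr by (simp only: nat_pow_mult)
        also have "\<dots> = (?x [^] \<omega> \<otimes> ?x [^] \<omega>) \<otimes> ?x [^] Suc c"
          using carr omega_idem by simp
        also have "\<dots> = ?x [^] (\<omega> + c) \<otimes> ?x [^] (\<omega> + 1)"
          using carr by (simp only: nat_pow_mult) (simp add: ac_simps)
        finally show ?thesis .
      qed
      show ?case
        unfolding split using Suc carr omega_Suc_central[of ?x "h [b]"]
        by (metis m_assoc nat_pow_closed)
    qed
    have "?x [^] \<omega> \<otimes> h (b # w) = h [b] \<otimes> (?x [^] \<omega> \<otimes> h w)"
      using carr h_Cons[OF b w'(1)] omega_central[of ?x "h [b]"]
      by (simp add: m_assoc[symmetric])
    also have "\<dots> = h [b] \<otimes> ?x [^] (\<omega> + count_list w a) \<otimes> h ?w"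
      using Cons.IH carr by (simp add: m_assoc)
    also have "\<dots> = ?x [^] (\<omega> + count_list w a) \<otimes> (h [b] \<otimes> h ?w)"
      using carr by (simp only: comm[symmetric] m_assoc nat_pow_closed)
    finally show ?thesis
      using False h_Cons[OF b w'(2)] by simp
  qed
qed

text \<open>The letters of \<open>F\<close> are pulled out of both words one at a time, and their
  powers accumulate in \<open>E\<close>; hence the induction generalizes over \<open>E\<close> and
  both words. Once \<open>F\<close> is exhausted the two words coincide.\<close>

lemma absorbing_eq:
  assumes "finite F" "F \<subseteq> \<Sigma>" "u \<in> lists \<Sigma>" "v \<in> lists \<Sigma>" "E \<in> carrier M"
    and "\<forall>a\<in>F. E \<otimes> h [a] [^] \<omega> = E"
    and "filter (\<lambda>b. b \<notin> F) u = filter (\<lambda>b. b \<notin> F) v"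
    and "\<forall>a\<in>F. [count_list u a = count_list v a] (mod p)"
  shows "E \<otimes> h u = E \<otimes> h v"
  using assms
proof (induction F arbitrary: u v E rule: finite_induct)
  case empty
  then show ?case by simp
next
  case (insert a F)
  let ?x = "h [a]" and ?del = "filter (\<lambda>b. b \<noteq> a)"
  note E = \<open>E \<in> carrier M\<close> and words = \<open>u \<in> lists \<Sigma>\<close> \<open>v \<in> lists \<Sigma>\<close>
  have a: "a \<in> \<Sigma>" and x: "?x \<in> carrier M"
    using insert.prems letter_closed by auto
  define E' where "E' = E \<otimes> ?x [^] (\<omega> + count_list u a)"
  have E': "E' \<in> carrier M"
    using E x by (simp add: E'_def)
  \<comment> \<open>Here the counts modulo \<open>p\<close> enter: both words contribute the same
    factor, so a single \<open>E'\<close> serves for both.\<close>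
  have "?x [^] (\<omega> + count_list u a) = ?x [^] (\<omega> + count_list v a)"
    using insert.prems x by (intro omega_period) auto
  then have E'_v: "E' = E \<otimes> ?x [^] (\<omega> + count_list v a)"
    by (simp add: E'_def)
  have pull: "E \<otimes> h w = (E \<otimes> ?x [^] (\<omega> + count_list w a)) \<otimes> h (?del w)"
    if w: "w \<in> lists \<Sigma>" for w
  proof -
    have del: "h (?del w) \<in> carrier M"
      using w by (intro h_closed) auto
    have "E \<otimes> h w = E \<otimes> (?x [^] \<omega> \<otimes> h w)"
      using insert.prems E x w h_closed[OF w] by (simp add: m_assoc[symmetric])
    then show ?thesis
      using E x del by (simp only: pull_out_letter[OF a w] m_assoc nat_pow_closed)
  qed
  have "E' \<otimes> h (?del u) = E' \<otimes> h (?del v)"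
  proof (rule insert.IH)
    show "\<forall>b\<in>F. E' \<otimes> h [b] [^] \<omega> = E'"
    proof
      fix b assume b: "b \<in> F"
      then have y: "h [b] \<in> carrier M" and Eb: "E \<otimes> h [b] [^] \<omega> = E"
        using insert.prems letter_closed by auto
      have "E' \<otimes> h [b] [^] \<omega> = E \<otimes> (h [b] [^] \<omega> \<otimes> ?x [^] (\<omega> + count_list u a))"
        using E x y omega_central[OF y, of "?x [^] (\<omega> + count_list u a)"]
        by (simp add: E'_def m_assoc)
      also have "\<dots> = E'"
        using E x y Eb by (simp add: E'_def m_assoc[symmetric])
      finally show "E' \<otimes> h [b] [^] \<omega> = E'" .
    qed
    have "filter (\<lambda>b. b \<notin> F) (?del w) = filter (\<lambda>b. b \<notin> insert a F) w" for w
      by (simp add: conj_commute)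
    then show "filter (\<lambda>b. b \<notin> F) (?del u) = filter (\<lambda>b. b \<notin> F) (?del v)"
      using insert.prems by simp
    have "count_list (?del w) b = count_list w b" if "b \<in> F" for w b
    proof -
      have "b \<noteq> a"
        using that insert.hyps by blast
      then show ?thesis
        by (induction w) auto
    qed
    then show "\<forall>b\<in>F. [count_list (?del u) b = count_list (?del v) b] (mod p)"
      using insert.prems by simp
  qed (use insert.prems E' in auto)
  then show ?case
    using pull[OF words(1)] pull[OF words(2)] by (simp flip: E'_def E'_v)
qed

text \<open>\<open>E\<close> is the product of the central idempotents a^\<omega> over the letters
  of \<open>F\<close>. Only its two absorption properties are recorded, so no product over a set in
  a noncommutative monoid has to be defined.\<close>

lemma exists_common_absorber:
  assumes "finite F" "F \<subseteq> \<Sigma>"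
  shows "\<exists>E\<in>carrier M. (\<forall>a\<in>F. E \<otimes> h [a] [^] \<omega> = E) \<and>
    (\<forall>m\<in>carrier M. (\<forall>a\<in>F. h [a] [^] \<omega> \<otimes> m = m) \<longrightarrow> E \<otimes> m = m)"
  using assms
proof (induction F rule: finite_induct)
  case empty
  show ?case by (rule bexI[of _ \<one>]) auto
next
  case (insert a F)
  then obtain E where E: "E \<in> carrier M" "\<forall>b\<in>F. E \<otimes> h [b] [^] \<omega> = E"
      "\<forall>m\<in>carrier M. (\<forall>b\<in>F. h [b] [^] \<omega> \<otimes> m = m) \<longrightarrow> E \<otimes> m = m"
    by auto
  have letters: "h [b] \<in> carrier M" if "b \<in> insert a F" for b
    using insert.prems that letter_closed by auto
  show ?case
  proof (intro bexI[of _ "E \<otimes> h [a] [^] \<omega>"] conjI ballI impI)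
    fix b assume b: "b \<in> insert a F"
    have y: "h [b] \<in> carrier M" and x: "h [a] \<in> carrier M"
      using letters b by auto
    show "E \<otimes> h [a] [^] \<omega> \<otimes> h [b] [^] \<omega> = E \<otimes> h [a] [^] \<omega>"
    proof (cases "b = a")
      case True
      then show ?thesis
        using E(1) x omega_idem by (simp add: m_assoc)
    next
      case False
      then have "E \<otimes> h [b] [^] \<omega> = E"
        using E(2) b by auto
      then show ?thesis
        using E(1) x y omega_central[OF x, of "h [b] [^] \<omega>"]
        by (metis m_assoc nat_pow_closed)
    qed
  qed (use E letters in \<open>auto simp: m_assoc\<close>)
qed

text \<open>The frequent letters are the same in both words and occur more than |M| times in each,
  so both images absorb the common \<open>E\<close>. Behind \<open>E\<close>,
  \<open>absorbing_eq\<close> exchanges \<open>u\<close> for \<open>v\<close>.\<close>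

theorem np_congruence_imp_eq:
  assumes fin: "finite \<Sigma>" and n: "card (carrier M) \<le> n"
    and uv: "(u, v) \<in> np_congruence \<Sigma> n p"
  shows "h u = h v"
proof -
  define F where "F = {a\<in>\<Sigma>. n < count_list u a}"
  have words: "u \<in> lists \<Sigma>" "v \<in> lists \<Sigma>"
    and rare: "rare_subword n u = rare_subword n v"
    and freq: "\<And>a. a \<in> \<Sigma> \<Longrightarrow> n < count_list u a \<longleftrightarrow> n < count_list v a"
    and cong: "\<And>a. a \<in> \<Sigma> \<Longrightarrow> [count_list u a = count_list v a] (mod p)"
    using uv by (auto simp: np_congruence_def)
  have F: "finite F" "F \<subseteq> \<Sigma>"
    using fin by (auto simp: F_def)
  obtain E where E: "E \<in> carrier M" "\<forall>a\<in>F. E \<otimes> h [a] [^] \<omega> = E"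
    and absorb: "\<And>m. m \<in> carrier M \<Longrightarrow> (\<forall>a\<in>F. h [a] [^] \<omega> \<otimes> m = m) \<Longrightarrow> E \<otimes> m = m"
    using exists_common_absorber[OF F] by blast
  have "E \<otimes> h u = h u" "E \<otimes> h v = h v"
    using words freq n
    by (auto intro!: absorb h_closed frequent_absorb simp: F_def)
  moreover have "b \<notin> F \<longleftrightarrow> count_list u b \<le> n" "b \<notin> F \<longleftrightarrow> count_list v b \<le> n" if "b \<in> \<Sigma>" for b
    using that freq[OF that] by (auto simp: F_def)
  \<comment> \<open>Deleting the frequent letters leaves the rare subword, so equality of the rare
    subwords is the filter hypothesis of \<open>absorbing_eq\<close>.\<close>
  then have "filter (\<lambda>b. b \<notin> F) u = rare_subword n u" "filter (\<lambda>b. b \<notin> F) v = rare_subword n v"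
    using words by (auto simp: rare_subword_def intro!: filter_cong)
  then have "E \<otimes> h u = E \<otimes> h v"
    using words rare cong F E by (intro absorbing_eq[OF F]) auto
  ultimately show ?thesis
    by metis
qed

end

theorem theorem3p4:
  fixes p :: nat and \<Sigma> :: "'a set" and R :: "('a list \<times> 'a list) set"
  assumes "0 < p"
    and "finite \<Sigma>"
    and "ZG_congruence p \<Sigma> R"
  shows "\<forall>u\<in>lists \<Sigma>. \<forall>v\<in>lists \<Sigma>.
    (u, v) \<in> np_congruence \<Sigma> (card (carrier (word_quotient \<Sigma> R)) + 1) p \<longrightarrow> (u, v) \<in> R"
proof (intro ballI impI)
  fix u v
  assume words: "u \<in> lists \<Sigma>" "v \<in> lists \<Sigma>"
    and uv: "(u, v) \<in> np_congruence \<Sigma> (card (carrier (word_quotient \<Sigma> R)) + 1) p"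
  have cong: "word_congruence \<Sigma> R" and ZG: "ZG p (word_quotient \<Sigma> R)"
    using assms(3) by (simp_all add: ZG_congruence_def)
  have equiv: "equiv (lists \<Sigma>) R"
    using cong by (simp add: word_congruence_def)
  interpret monoid "word_quotient \<Sigma> R"
    by (rule monoid_word_quotient[OF cong])
  \<comment> \<open>The morphism is the canonical projection, so equal images mean equivalent
    words.\<close>
  interpret ZG_morphism "word_quotient \<Sigma> R" p \<Sigma> "\<lambda>w. R `` {w}"
  proof
    show "R `` {w} \<in> carrier (word_quotient \<Sigma> R)" if "w \<in> lists \<Sigma>" for w
      using that by (simp add: word_quotient_def quotientI)
    show "R `` {[]} = \<one>\<^bsub>word_quotient \<Sigma> R\<^esub>"
      by (simp add: word_quotient_def)
  qed (simp_all only: ZG word_quotient_mult[OF cong])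
  have "R `` {u} = R `` {v}"
    using uv by (intro np_congruence_imp_eq[OF assms(2)]) auto
  then show "(u, v) \<in> R"
    using eq_equiv_class_iff[OF equiv words] by simp
qed

end
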